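(* Let $f, g$ be numerical polynomials, or more generally $f, g \in \mathbf{QP}_{\gg 0}$. Define $d(n) = \gcd(f(n), g(n))$. Then $d \in \mathbf{QP}_{\gg 0}$.
   Context: A numerical polynomial is a function $f\colon \mathbf{Z}\to\mathbf{Z}$ agreeing at all integers with some polynomial in $\mathbf{Q}[x]$. A function $f$ with integer values defined on all sufficiently large integers is eventually a quasi-polynomial if there exist a positive integer $s$ and polynomials $f_0,\dots,f_{s-1} \in \mathbf{Q}[t]$ such that $f(n) = f_i(n)$ for all sufficiently large $n$ with $n \equiv i \pmod s$; $\mathbf{QP}_{\gg 0}$ denotes the set (a ring under pointwise operations) of such functions. The function $d$ is called the generalized gcd of $f$ and $g$, written $\operatorname{ggcd}(f,g)$. *)

theory Defs
  imports
    "HOL-Computational_Algebra.Polynomial"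
    "HOL-Number_Theory.Cong"
begin

definition numerical_polynomial :: "(int \<Rightarrow> int) \<Rightarrow> bool" where
  "numerical_polynomial f \<longleftrightarrow>
     (\<exists>p :: rat poly. \<forall>n. of_int (f n) = poly p (of_int n))"

text \<open>
  A function defined only for sufficiently large integers is represented by an arbitrary
  total extension: the condition below constrains no values outside a neighbourhood of
  \<^term>\<open>at_top\<close>, so membership does not depend on the extension chosen.
\<close>

definition eventual_quasi_polynomials :: "(int \<Rightarrow> int) set" where
  "eventual_quasi_polynomials =
     {f. \<exists>s :: nat. s > 0 \<and> (\<exists>p :: nat \<Rightarrow> rat poly. \<forall>i<s.
           \<forall>\<^sub>F n in at_top. [n = int i] (mod int s) \<longrightarrow> of_int (f n) = poly (p i) (of_int n))}"

definition ggcd :: "(int \<Rightarrow> int) \<Rightarrow> (int \<Rightarrow> int) \<Rightarrow> (int \<Rightarrow> int)" where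
  "ggcd f g = (\<lambda>n. gcd (f n) (g n))"

end

theory Submission
  imports Defs
    "HOL-Computational_Algebra.Polynomial_Factorial"
    "HOL-Computational_Algebra.Field_as_Ring"
begin

text \<open>
  On a residue class \<open>f\<close> and \<open>g\<close> are given by rational polynomials \<open>F = H a\<close> and \<open>G = H b\<close>
  with \<open>H = gcd F G\<close>. After clearing denominators, the Bezout identity \<open>u a + v b = 1\<close> shows that
  the gcd of the values of \<open>a\<close> and \<open>b\<close> divides a fixed positive integer \<open>K\<close>, so it depends only
  on the argument modulo \<open>K\<close>. Hence on each class modulo \<open>K\<close> the gcd of the values of \<open>F\<close> and
  \<open>G\<close> is a constant times the absolute value of \<open>H\<close>, and \<open>H\<close> has eventually constant sign.
\<close>

section \<open>Integer-valued forms of polynomials: denominators, congruences, eventual sign\<close>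

lemma clear_denominators_poly:
  fixes p :: "rat poly"
  obtains N :: int and q :: "int poly"
  where "N > 0" "\<And>n. of_int N * poly p (of_int n) = of_int (poly q n)"
proof -
  have "\<exists>N>0. \<exists>q::int poly. \<forall>n. of_int N * poly p (of_int n) = of_int (poly q n)"
  proof (induction p)
    case 0
    have "\<forall>n. of_int 1 * poly (0 :: rat poly) (of_int n) = of_int (poly 0 n)"
      by simp
    then show ?case
      using zero_less_one by blast
  next
    case (pCons a p)
    then obtain N q where N: "N > 0"
      and q: "\<And>n. of_int N * poly p (of_int n) = of_int (poly q n)"
      by blast
    obtain x y where xy: "quotient_of a = (x, y)"
      by (cases "quotient_of a")
    have y: "y > 0" and a: "a = of_int x / of_int y"
      using quotient_of_denom_pos[OF xy] quotient_of_div[OF xy] by auto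
    have "of_int (N * y) * poly (pCons a p) (of_int n)
            = of_int (poly (pCons (N * x) (smult y q)) n)" for n
    proof -
      have "of_int (N * y) * poly (pCons a p) (of_int n)
              = of_int N * (of_int y * a) + of_int y * of_int n * (of_int N * poly p (of_int n))"
        by (simp add: algebra_simps)
      also have "of_int y * a = of_int x"
        using y a by simp
      finally show ?thesis
        by (simp add: q algebra_simps)
    qed
    then show ?case
      using N y by (meson mult_pos_pos)
  qed
  then show ?thesis
    using that by blast
qed

lemma cong_poly_int:
  fixes q :: "int poly"
  assumes "[n = m] (mod k)"
  shows "[poly q n = poly q m] (mod k)"
  by (induction q) (auto intro!: cong_add cong_mult assms)

text \<open>Induction on the coefficients: if \<open>q\<close> is eventually at least 1 or at most
  -1, then for large \<open>n\<close> the summand \<open>n * poly q n\<close> has absolute value at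
  least \<open>n\<close> and outweighs the constant term \<open>a\<close>. The bounds 1 and -1,
  rather than mere signs, are what this step needs.\<close>

lemma eventually_sign_poly_int:
  fixes q :: "int poly"
  shows "q = 0 \<or> (\<forall>\<^sub>F n in at_top. poly q n \<ge> 1) \<or> (\<forall>\<^sub>F n in at_top. poly q n \<le> -1)"
proof (induction q)
  case 0
  then show ?case by simp
next
  case (pCons a q)
  consider "q = 0" | "\<forall>\<^sub>F n in at_top. poly q n \<ge> 1" | "\<forall>\<^sub>F n in at_top. poly q n \<le> -1"
    using pCons by blast
  then show ?case
  proof cases
    case 1
    then show ?thesis
      \<comment> \<open>Here the polynomial is the constant \<open>a\<close>, and \<open>a\<close>
        is nonzero because \<open>pCons.hyps\<close> excludes \<open>a\<close> and \<open>q\<close>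
        both being zero.\<close>
      using pCons.hyps by (cases a "0 :: int" rule: linorder_cases) auto
  next
    case 2
    then have "\<forall>\<^sub>F n in at_top. poly (pCons a q) n \<ge> 1"
      using eventually_ge_at_top[of 0] eventually_ge_at_top[of "1 - a"]
    proof eventually_elim
      case (elim n)
      have "n * 1 \<le> n * poly q n"
        using elim by (intro mult_left_mono) auto
      then show ?case using elim by simp
    qed
    then show ?thesis by blast
  next
    case 3
    then have "\<forall>\<^sub>F n in at_top. poly (pCons a q) n \<le> -1"
      using eventually_ge_at_top[of 0] eventually_ge_at_top[of "1 + a"]
    proof eventually_elim
      case (elim n)
      have "n * poly q n \<le> n * (-1)"
        using elim by (intro mult_left_mono) auto
      then show ?case using elim by simp
    qed
    then show ?thesis by blast
  qed
qed

text \<open>A gcd is non-negative, so absolute values appear; the eventual sign \<open>e\<close>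
  turns them back into polynomials.\<close>

lemma eventually_abs_poly_int:
  fixes q :: "int poly"
  obtains e :: int where "\<forall>\<^sub>F n in at_top. \<bar>poly q n\<bar> = e * poly q n"
proof -
  consider "q = 0" | "\<forall>\<^sub>F n in at_top. poly q n \<ge> 1" | "\<forall>\<^sub>F n in at_top. poly q n \<le> -1"
    using eventually_sign_poly_int by blast
  then show ?thesis
  proof cases
    case 1
    then show ?thesis using that[of 1] by simp
  next
    case 2
    then have "\<forall>\<^sub>F n in at_top. \<bar>poly q n\<bar> = 1 * poly q n"
      by eventually_elim simp
    then show ?thesis by (rule that)
  next
    case 3
    then have "\<forall>\<^sub>F n in at_top. \<bar>poly q n\<bar> = - 1 * poly q n"
      by eventually_elim simp
    then show ?thesis by (rule that)
  qed
qed

section \<open>The gcd of the values of two polynomials\<close>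

text \<open>Each gcd divides \<open>K\<close> by the Bezout identity. Hence a congruence modulo
  \<open>K\<close> is also one modulo the gcd at \<open>n\<close>, which therefore divides the
  values at \<open>m\<close>; by symmetry the two gcds divide each other.\<close>

lemma gcd_poly_int_periodic:
  fixes A B U V :: "int poly"
  assumes bezout: "\<And>n. poly U n * poly A n + poly V n * poly B n = K"
    and cong: "[n = m] (mod K)"
  shows "gcd (poly A n) (poly B n) = gcd (poly A m) (poly B m)"
proof -
  have dvd: "gcd (poly A n) (poly B n) dvd gcd (poly A m) (poly B m)"
    if "[n = m] (mod K)" for n m
  proof -
    let ?d = "gcd (poly A n) (poly B n)"
    have "?d dvd K"
      unfolding bezout[of n, symmetric] by simp
    then have "[poly A n = poly A m] (mod ?d)" "[poly B n = poly B m] (mod ?d)"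
      using cong_poly_int[OF that] cong_dvd_modulus by blast+
    then have "?d dvd poly A m" "?d dvd poly B m"
      using cong_dvd_iff by (metis gcd_dvd1, metis gcd_dvd2)
    then show ?thesis by simp
  qed
  show ?thesis
    using dvd[OF cong] dvd[OF cong_sym[OF cong]] by (intro zdvd_antisym_nonneg) auto
qed

text \<open>The hypothesis makes the gcd \<open>H\<close> nonzero, so it cancels from
  \<open>u * F + v * G = H\<close>.\<close>

lemma bezout_cofactors:
  fixes F G :: "rat poly"
  assumes "F \<noteq> 0 \<or> G \<noteq> 0"
  obtains H a b u v where "F = H * a" "G = H * b" "u * a + v * b = 1"
proof -
  define H where "H = gcd F G"
  have "H dvd F" "H dvd G" and "H \<noteq> 0"
    using assms by (auto simp: H_def)
  then obtain a b where ab: "F = H * a" "G = H * b"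
    by (blast elim: dvdE)
  obtain u v where uv: "u * F + v * G = H"
    unfolding H_def using bezout_coefficients_fst_snd by blast
  have "H * (u * a + v * b) = H * 1"
    using uv unfolding ab by (simp only: algebra_simps mult_1_right)
  then have "u * a + v * b = 1"
    using \<open>H \<noteq> 0\<close> by (simp only: mult_cancel_left simp_thms)
  then show ?thesis
    using ab that by blast
qed

text \<open>The values of \<open>F\<close> and \<open>G\<close> need not be integers at every
  \<open>n\<close>. Quantifying over integers \<open>x\<close> and \<open>y\<close> equal to these
  values restricts the claim to points where the gcd makes sense. One modulus \<open>t\<close>
  serves all residues \<open>m\<close>.\<close>

lemma gcd_poly_values_quasi_polynomial:
  fixes F G :: "rat poly"
  shows "\<exists>t::int. t > 0 \<and> (\<forall>m. \<exists>p::rat poly. \<forall>\<^sub>F n in at_top. [n = m] (mod t) \<longrightarrow>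
           (\<forall>x y::int. of_int x = poly F (of_int n) \<longrightarrow> of_int y = poly G (of_int n)
              \<longrightarrow> of_int (gcd x y) = poly p (of_int n)))"
proof (cases "F = 0 \<and> G = 0")
  case True
  then show ?thesis
    by (intro exI[of _ 1] conjI allI exI[of _ 0]) auto
next
  case False
  then obtain H a b u v where FG: "F = H * a" "G = H * b" and uv: "u * a + v * b = 1"
    using bezout_cofactors by blast
  obtain L E where L: "L > 0" and E: "\<And>n. of_int L * poly H (of_int n) = of_int (poly E n)"
    using clear_denominators_poly[of H] by blast
  obtain Na A where Na: "Na > 0" and A: "\<And>n. of_int Na * poly a (of_int n) = of_int (poly A n)"
    using clear_denominators_poly[of a] by blast
  obtain Nb B where Nb: "Nb > 0" and B: "\<And>n. of_int Nb * poly b (of_int n) = of_int (poly B n)"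
    using clear_denominators_poly[of b] by blast
  obtain Nu U where Nu: "Nu > 0" and U: "\<And>n. of_int Nu * poly u (of_int n) = of_int (poly U n)"
    using clear_denominators_poly[of u] by blast
  obtain Nv V where Nv: "Nv > 0" and V: "\<And>n. of_int Nv * poly v (of_int n) = of_int (poly V n)"
    using clear_denominators_poly[of v] by blast
  \<comment> \<open>\<open>N\<close> is a common denominator: \<open>A'\<close> and
    \<open>B'\<close> below take the values of \<open>a\<close> and \<open>b\<close> times the same
    factor \<open>N\<close>. Multiplying \<open>u * a + v * b = 1\<close> by \<open>K\<close> then
    also clears the denominators of \<open>u\<close> and \<open>v\<close>.\<close>
  define N where "N = Na * Nb"
  define K where "K = Nu * Nv * N"
  have N: "N > 0" and K: "K > 0"
    using Na Nb Nu Nv by (auto simp: N_def K_def)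
  define A' where "A' = smult Nb A"
  define B' where "B' = smult Na B"
  have A': "of_int (poly A' n) = of_int N * poly a (of_int n)" for n
    by (simp add: A'_def N_def A[symmetric])
  have B': "of_int (poly B' n) = of_int N * poly b (of_int n)" for n
    by (simp add: B'_def N_def B[symmetric])
  have bezout: "poly (smult Nv U) n * poly A' n + poly (smult Nu V) n * poly B' n = K" for n
  proof -
    have "of_int (poly (smult Nv U) n * poly A' n + poly (smult Nu V) n * poly B' n)
            = (of_int K :: rat) * poly (u * a + v * b) (of_int n)"
      by (simp add: A' B' U[symmetric] V[symmetric] K_def algebra_simps)
    then have "of_int (poly (smult Nv U) n * poly A' n + poly (smult Nu V) n * poly B' n)
            = (of_int K :: rat)"
      by (simp only: uv) simp
    then show ?thesis
      by (simp only: of_int_eq_iff)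
  qed
  obtain e where e: "\<forall>\<^sub>F n in at_top. \<bar>poly E n\<bar> = e * poly E n"
    by (rule eventually_abs_poly_int)
  have "\<exists>p::rat poly. \<forall>\<^sub>F n in at_top. [n = m] (mod K) \<longrightarrow>
           (\<forall>x y::int. of_int x = poly F (of_int n) \<longrightarrow> of_int y = poly G (of_int n)
              \<longrightarrow> of_int (gcd x y) = poly p (of_int n))" for m
  proof -
    define c where "c = gcd (poly A' m) (poly B' m)"
    \<comment> \<open>Found by solving \<open>L * N * gcd x y = e * poly E n * c\<close> for the
      gcd: \<open>E\<close> takes the values of \<open>L\<close> times \<open>H\<close>, so
      \<open>L\<close> cancels.\<close>
    define p where "p = smult (of_int (e * c) / of_int N) H"
    have "\<forall>\<^sub>F n in at_top. [n = m] (mod K) \<longrightarrow>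
           (\<forall>x y::int. of_int x = poly F (of_int n) \<longrightarrow> of_int y = poly G (of_int n)
              \<longrightarrow> of_int (gcd x y) = poly p (of_int n))"
      using e
    proof (eventually_elim, intro impI allI)
      fix n x y
      assume abs: "\<bar>poly E n\<bar> = e * poly E n" and nm: "[n = m] (mod K)"
        and x: "of_int x = poly F (of_int n)" and y: "of_int y = poly G (of_int n)"
      \<comment> \<open>Scaling by \<open>L * N\<close> exhibits both values as integer multiples of
        \<open>poly E n\<close>, which can then be pulled out of the gcd.\<close>
      have "of_int (L * N * x) = (of_int (poly E n * poly A' n) :: rat)"
        by (simp add: x FG A' E[symmetric])
      then have x': "L * N * x = poly E n * poly A' n"
        by (simp only: of_int_eq_iff)
      have "of_int (L * N * y) = (of_int (poly E n * poly B' n) :: rat)"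
        by (simp add: y FG B' E[symmetric])
      then have y': "L * N * y = poly E n * poly B' n"
        by (simp only: of_int_eq_iff)
      have "L * N * gcd x y = gcd (L * N * x) (L * N * y)"
        using L N by (simp add: gcd_mult_distrib_int[symmetric] abs_mult)
      also have "\<dots> = \<bar>poly E n\<bar> * gcd (poly A' n) (poly B' n)"
        by (simp add: x' y' gcd_mult_distrib_int[symmetric])
      also have "gcd (poly A' n) (poly B' n) = c"
        unfolding c_def by (rule gcd_poly_int_periodic[OF bezout nm])
      finally have "of_int (L * N * gcd x y) = (of_int (e * poly E n * c) :: rat)"
        by (simp only: abs)
      then have "of_int L * (of_int N * of_int (gcd x y))
                   = of_int L * (of_int (e * c) * poly H (of_int n))"
        by (simp add: E[symmetric] algebra_simps)
      then have "of_int N * of_int (gcd x y) = of_int (e * c) * poly H (of_int n)"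
        using L by (simp only: mult_cancel_left) simp
      then show "of_int (gcd x y) = poly p (of_int n)"
        using N by (simp add: p_def field_simps)
    qed
    then show ?thesis by blast
  qed
  then show ?thesis
    using K by blast
qed

section \<open>Quasi-polynomials and the generalized gcd\<close>

text \<open>Integer periods and arbitrary integer representatives of the classes spare later
  arguments the conversions between \<open>nat\<close> and \<open>int\<close>.\<close>

lemma eventual_quasi_polynomials_iff:
  "f \<in> eventual_quasi_polynomials \<longleftrightarrow>
     (\<exists>s::int. s > 0 \<and> (\<forall>i. \<exists>p::rat poly.
        \<forall>\<^sub>F n in at_top. [n = i] (mod s) \<longrightarrow> of_int (f n) = poly p (of_int n)))"
  (is "_ \<longleftrightarrow> ?R")
proof
  assume "f \<in> eventual_quasi_polynomials"
  then obtain s :: nat and p :: "nat \<Rightarrow> rat poly" where s: "s > 0"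
    and p: "\<And>i. i < s \<Longrightarrow> \<forall>\<^sub>F n in at_top.
              [n = int i] (mod int s) \<longrightarrow> of_int (f n) = poly (p i) (of_int n)"
    by (auto simp: eventual_quasi_polynomials_def)
  have "\<exists>p::rat poly. \<forall>\<^sub>F n in at_top.
          [n = i] (mod int s) \<longrightarrow> of_int (f n) = poly p (of_int n)" for i
  proof -
    have "nat (i mod int s) < s"
      using s by (simp add: nat_less_iff)
    from p[OF this] have "\<forall>\<^sub>F n in at_top.
        [n = i] (mod int s) \<longrightarrow> of_int (f n) = poly (p (nat (i mod int s))) (of_int n)"
      using s by (simp add: cong_def)
    then show ?thesis ..
  qed
  then show ?R
    using s by (intro exI[of _ "int s"]) simp
next
  assume ?R
  then obtain s :: int and p :: "int \<Rightarrow> rat poly" where s: "s > 0"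
    and p: "\<And>i. \<forall>\<^sub>F n in at_top. [n = i] (mod s) \<longrightarrow> of_int (f n) = poly (p i) (of_int n)"
    by metis
  then show "f \<in> eventual_quasi_polynomials"
    unfolding eventual_quasi_polynomials_def
    by (intro CollectI exI[of _ "nat s"] conjI exI[of _ "\<lambda>i. p (int i)"]) auto
qed

lemma numerical_polynomial_imp_eventual_quasi_polynomial:
  assumes "numerical_polynomial f"
  shows "f \<in> eventual_quasi_polynomials"
proof -
  obtain p :: "rat poly" where "\<And>n. of_int (f n) = poly p (of_int n)"
    using assms unfolding numerical_polynomial_def by blast
  then show ?thesis
    unfolding eventual_quasi_polynomials_iff by (intro exI[of _ 1] conjI allI exI[of _ p]) auto
qed

text \<open>On each class modulo \<open>s * s'\<close> both functions are given by single
  polynomials, and the gcd of their values becomes polynomial after refining the class. As there are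
  finitely many classes, one common period suffices.\<close>

lemma ggcd_eventual_quasi_polynomial:
  assumes "f \<in> eventual_quasi_polynomials" "g \<in> eventual_quasi_polynomials"
  shows "ggcd f g \<in> eventual_quasi_polynomials"
proof -
  obtain s F where s: "(s::int) > 0"
    and F: "\<And>i. \<forall>\<^sub>F n in at_top. [n = i] (mod s) \<longrightarrow> of_int (f n) = poly (F i :: rat poly) (of_int n)"
    using assms(1) unfolding eventual_quasi_polynomials_iff by metis
  obtain s' G where s': "(s'::int) > 0"
    and G: "\<And>i. \<forall>\<^sub>F n in at_top. [n = i] (mod s') \<longrightarrow> of_int (g n) = poly (G i :: rat poly) (of_int n)"
    using assms(2) unfolding eventual_quasi_polynomials_iff by metis
  define S where "S = s * s'"
  have S: "S > 0"
    using s s' by (simp add: S_def)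
  have "\<exists>t. \<forall>i. t i > (0::int) \<and> (\<forall>m. \<exists>p::rat poly. \<forall>\<^sub>F n in at_top. [n = m] (mod t i) \<longrightarrow>
           (\<forall>x y::int. of_int x = poly (F i) (of_int n) \<longrightarrow> of_int y = poly (G i) (of_int n)
              \<longrightarrow> of_int (gcd x y) = poly p (of_int n)))"
    by (rule choice) (use gcd_poly_values_quasi_polynomial in blast)
  then obtain t where t: "\<And>i. (t i :: int) > 0"
    and ex: "\<And>i m. \<exists>p::rat poly. \<forall>\<^sub>F n in at_top. [n = m] (mod t i) \<longrightarrow>
           (\<forall>x y::int. of_int x = poly (F i) (of_int n) \<longrightarrow> of_int y = poly (G i) (of_int n)
              \<longrightarrow> of_int (gcd x y) = poly p (of_int n))"
    by auto
  \<comment> \<open>The factor \<open>S\<close> fixes the polynomials \<open>F i\<close> and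
    \<open>G i\<close>; the product is a common multiple of the refining moduli over a full set of
    residues modulo \<open>S\<close>.\<close>
  define T where "T = S * (\<Prod>i\<in>{0..<S}. t i)"
  have T: "T > 0"
    using S t by (simp add: T_def prod_pos)
  have "\<exists>p::rat poly. \<forall>\<^sub>F n in at_top.
          [n = m] (mod T) \<longrightarrow> of_int (ggcd f g n) = poly p (of_int n)" for m
  proof -
    \<comment> \<open>The product in \<open>T\<close> runs over \<open>{0..<S}\<close> only, so
      \<open>m\<close> is reduced into that range to ensure that \<open>t i\<close> divides
      \<open>T\<close>.\<close>
    define i where "i = m mod S"
    have i: "i \<in> {0..<S}"
      using S by (simp add: i_def)
    have im: "[m = i] (mod S)"
      by (simp add: i_def cong_def)
    have "t i dvd (\<Prod>i\<in>{0..<S}. t i)"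
      using i by (intro dvd_prodI) auto
    then have dvd: "S dvd T" "t i dvd T"
      by (auto simp: T_def)
    obtain p :: "rat poly" where p: "\<forall>\<^sub>F n in at_top. [n = m] (mod t i) \<longrightarrow>
           (\<forall>x y::int. of_int x = poly (F i) (of_int n) \<longrightarrow> of_int y = poly (G i) (of_int n)
              \<longrightarrow> of_int (gcd x y) = poly p (of_int n))"
      using ex by blast
    have "\<forall>\<^sub>F n in at_top. [n = m] (mod T) \<longrightarrow> of_int (ggcd f g n) = poly p (of_int n)"
      using p F[of i] G[of i]
    proof eventually_elim
      case (elim n)
      show ?case
      proof
        assume nm: "[n = m] (mod T)"
        have ni: "[n = i] (mod S)"
          using cong_trans[OF cong_dvd_modulus[OF nm dvd(1)] im] .
        have "[n = i] (mod s)" "[n = i] (mod s')"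
          using cong_dvd_modulus[OF ni] by (auto simp: S_def)
        moreover have "[n = m] (mod t i)"
          using cong_dvd_modulus[OF nm dvd(2)] .
        ultimately show "of_int (ggcd f g n) = poly p (of_int n)"
          using elim by (simp add: ggcd_def)
      qed
    qed
    then show ?thesis by blast
  qed
  then show ?thesis
    unfolding eventual_quasi_polynomials_iff using T by blast
qed

theorem theorem4p3:
  fixes f g :: "int \<Rightarrow> int"
  assumes "(numerical_polynomial f \<and> numerical_polynomial g) \<or>
           (f \<in> eventual_quasi_polynomials \<and> g \<in> eventual_quasi_polynomials)"
  shows "ggcd f g \<in> eventual_quasi_polynomials"
  using assms ggcd_eventual_quasi_polynomial numerical_polynomial_imp_eventual_quasi_polynomial
  by blast

end
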